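(* Let $p$ be an odd prime, let $n$ be a positive integer and let $M$ be a free $\mathbb{Z}_p$-module of rank $n$. Let $M_1=(M,+,\cdot_1)$ and $M_2=(M,+,\cdot_2)$ be two commutative, $3$-nilpotent $\mathbb{Z}_p$-algebras (with underlying torsion-free module $M$) with cyclic annihilators, and let $\Theta_{M_1}$ and $\Theta_{M_2}$ be defining matrices of $M_1$ and $M_2$, respectively. Fix a unit $q\in\mathbb{Z}_p^\times$ that is not a square in $\mathbb{Z}_p$. Then $M_1$ and $M_2$ are isomorphic as $\mathbb{Z}_p$-algebras if and only if there exist a unimodular $(n-1)\times(n-1)$ matrix $A$ and $\varepsilon\in\{1,q\}$ such that $$A\,\Theta_{M_1}A^{tr}=\varepsilon\,\Theta_{M_2}.$$
   Context: $\mathbb{Z}_p$ is the ring of $p$-adic integers. A matrix is unimodular if its entries are in $\mathbb{Z}_p$ and its determinant is a unit of $\mathbb{Z}_p$. An algebra $(M,+,\cdot)$ is $3$-nilpotent if $M\cdot M\cdot M=0$. Its annihilator is $\mathrm{Ann}(M)=\{a\in M : a\cdot x=0 \text{ for all } x\in M\}$; it is called cyclic if it is cyclic as a $\mathbb{Z}_p$-module. Defining matrix: let $(M,+,\cdot)$ be a commutative $3$-nilpotent $\mathbb{Z}_p$-algebra, free of rank $n$ as a $\mathbb{Z}_p$-module, with $\mathrm{Ann}(M)$ cyclic. Then $M\cdot M\subseteq \mathrm{Ann}(M)$, and there is a basis $e_1,\dots,e_n$ of $M$ with $\mathrm{Ann}(M)=\mathbb{Z}_p e_n$. The defining matrix of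 $M$ in such a basis is the $(n-1)\times(n-1)$ matrix $\Theta=(\Theta_{i,j})$ over $\mathbb{Z}_p$ determined by $e_i\cdot e_j=\Theta_{i,j}e_n$ for $1\le i,j\le n-1$. *)

theory Defs
  imports "Jordan_Normal_Form.Determinant" "Berlekamp_Zassenhaus.Finite_Field"
begin

section \<open>The ring of p-adic integers\<close>

text \<open>
  The prime \<open>p\<close> is the cardinality of the index type \<open>'p\<close>, whose class \<open>prime_card\<close> says that
  \<open>CARD('p)\<close> is prime (as for the type \<open>'p mod_ring\<close> of residues modulo \<open>p\<close>).
  The type \<open>'p padic_int\<close> is the inverse limit of the rings of integers modulo \<open>p ^ k\<close>: a p-adic
  integer is a compatible sequence of residues, the one at \<open>k\<close> being represented in
  \<open>{0..<p ^ k}\<close>. The equation below forces both this range and compatibility.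
\<close>

typedef (overloaded) ('p::prime_card) padic_int =
  "{x :: nat \<Rightarrow> int. \<forall>k. x (Suc k) mod int CARD('p) ^ k = x k}"
  by (rule exI[of _ "\<lambda>_. 0"]) simp

setup_lifting type_definition_padic_int

lemma residue_mod_power: "(a mod q ^ Suc k) mod q ^ k = a mod (q ^ k :: int)"
  by (simp add: mod_mod_cancel)

instantiation padic_int :: (prime_card) comm_ring_1
begin

lift_definition zero_padic_int :: "'a padic_int" is "\<lambda>_. 0"
  by simp

lift_definition one_padic_int :: "'a padic_int" is "\<lambda>k. 1 mod int CARD('a) ^ k"
  by (simp only: residue_mod_power)

lift_definition plus_padic_int :: "'a padic_int \<Rightarrow> 'a padic_int \<Rightarrow> 'a padic_int"
  is "\<lambda>x y k. (x k + y k) mod int CARD('a) ^ k"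
  by (metis residue_mod_power mod_add_eq)

lift_definition minus_padic_int :: "'a padic_int \<Rightarrow> 'a padic_int \<Rightarrow> 'a padic_int"
  is "\<lambda>x y k. (x k - y k) mod int CARD('a) ^ k"
  by (metis residue_mod_power mod_diff_eq)

lift_definition uminus_padic_int :: "'a padic_int \<Rightarrow> 'a padic_int"
  is "\<lambda>x k. (- x k) mod int CARD('a) ^ k"
  by (metis residue_mod_power mod_minus_eq)

lift_definition times_padic_int :: "'a padic_int \<Rightarrow> 'a padic_int \<Rightarrow> 'a padic_int"
  is "\<lambda>x y k. (x k * y k) mod int CARD('a) ^ k"
  by (metis residue_mod_power mod_mult_eq)

instance
proof
  fix a b c :: "'a padic_int"
  show "a * b * c = a * (b * c)"
    by transfer (simp add: mod_mult_left_eq mod_mult_right_eq mult.assoc)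
  show "a * b = b * a"
    by transfer (simp add: mult.commute)
  show "1 * a = a"
    by transfer (rule ext, metis mod_mod_trivial mod_mult_left_eq mult_1)
  show "a + b + c = a + (b + c)"
    by transfer (simp add: mod_add_left_eq mod_add_right_eq add.assoc)
  show "a + b = b + a"
    by transfer (simp add: add.commute)
  show "0 + a = a"
    by transfer (rule ext, metis mod_mod_trivial add_0)
  show "- a + a = 0"
    by transfer (simp add: mod_add_left_eq)
  show "a - b = a + - b"
    by transfer (simp add: mod_add_right_eq)
  show "(a + b) * c = a * c + b * c"
    by transfer (simp add: mod_mult_left_eq mod_add_eq distrib_right)
  have "(1::int) < int CARD('a)"
    using prime_card[where 'a = 'a] prime_gt_1_nat by simp
  then show "(0::'a padic_int) \<noteq> 1"
    by transfer (auto simp: fun_eq_iff intro!: exI[of _ "Suc 0"])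
qed

end

section \<open>Algebras with cyclic annihilator\<close>

text \<open>
  \<open>Modules.module\<close> is the locale from HOL, where spans and linear dependence are defined over
  commutative rings; the name \<open>module\<close> alone would refer to HOL-Algebra.
\<close>

definition basis_family ::
    "('a::comm_ring_1 \<Rightarrow> 'b::ab_group_add \<Rightarrow> 'b) \<Rightarrow> nat \<Rightarrow> (nat \<Rightarrow> 'b) \<Rightarrow> bool" where
  "basis_family scale n e \<longleftrightarrow>
     inj_on e {..<n} \<and> \<not> Modules.module.dependent scale (e ` {..<n}) \<and>
     Modules.module.span scale (e ` {..<n}) = UNIV"

definition free_of_rank ::
    "('a::comm_ring_1 \<Rightarrow> 'b::ab_group_add \<Rightarrow> 'b) \<Rightarrow> nat \<Rightarrow> bool" where
  "free_of_rank scale n \<longleftrightarrow> (\<exists>e. basis_family scale n e)"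

definition cyclic_submodule ::
    "('a::comm_ring_1 \<Rightarrow> 'b::ab_group_add \<Rightarrow> 'b) \<Rightarrow> 'b set \<Rightarrow> bool" where
  "cyclic_submodule scale S \<longleftrightarrow> (\<exists>a. S = Modules.module.span scale {a})"

text \<open>
  Algebras need not have a unit. Associativity is listed as part of the notion of algebra; under
  \<open>nilpotent3\<close> below, commutativity makes it automatic.
\<close>

locale comm_algebra = Modules.module scale
  for scale :: "'a::comm_ring_1 \<Rightarrow> 'b::ab_group_add \<Rightarrow> 'b" +
  fixes mul :: "'b \<Rightarrow> 'b \<Rightarrow> 'b"
  assumes linear_left: "module_hom scale scale (\<lambda>x. mul x y)"
    and linear_right: "module_hom scale scale (\<lambda>y. mul x y)"
    and assoc: "mul (mul x y) z = mul x (mul y z)"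
    and commute: "mul x y = mul y x"

definition nilpotent3 :: "('b::zero \<Rightarrow> 'b \<Rightarrow> 'b) \<Rightarrow> bool" where
  "nilpotent3 mul \<longleftrightarrow> (\<forall>x y z. mul (mul x y) z = 0)"

definition annihilator :: "('b::zero \<Rightarrow> 'b \<Rightarrow> 'b) \<Rightarrow> 'b set" where
  "annihilator mul = {a. \<forall>x. mul a x = 0}"

text \<open>
  Bases and matrices are indexed from \<open>0\<close>, so that the basis vector spanning the annihilator is
  \<open>e (n - 1)\<close>.
\<close>

definition defining_matrix ::
    "('a::comm_ring_1 \<Rightarrow> 'b::ab_group_add \<Rightarrow> 'b) \<Rightarrow> nat \<Rightarrow> ('b \<Rightarrow> 'b \<Rightarrow> 'b) \<Rightarrow> 'a mat \<Rightarrow> bool" where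
  "defining_matrix scale n mul \<Theta> \<longleftrightarrow>
     \<Theta> \<in> carrier_mat (n - 1) (n - 1) \<and>
     (\<exists>e. basis_family scale n e \<and> annihilator mul = Modules.module.span scale {e (n - 1)} \<and>
        (\<forall>i<n - 1. \<forall>j<n - 1. mul (e i) (e j) = scale (\<Theta> $$ (i, j)) (e (n - 1))))"

definition algebra_isomorphic ::
    "('a::comm_ring_1 \<Rightarrow> 'b::ab_group_add \<Rightarrow> 'b) \<Rightarrow> ('b \<Rightarrow> 'b \<Rightarrow> 'b) \<Rightarrow>
     ('a \<Rightarrow> 'c::ab_group_add \<Rightarrow> 'c) \<Rightarrow> ('c \<Rightarrow> 'c \<Rightarrow> 'c) \<Rightarrow> bool" where
  "algebra_isomorphic scale1 mul1 scale2 mul2 \<longleftrightarrow>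
     (\<exists>f. module_hom scale1 scale2 f \<and> bij f \<and> (\<forall>x y. f (mul1 x y) = mul2 (f x) (f y)))"

definition unimodular :: "'a::comm_ring_1 mat \<Rightarrow> bool" where
  "unimodular A \<longleftrightarrow> square_mat A \<and> det A dvd 1"

end

theory Submission
  imports Defs "HOL-Number_Theory.Euler_Criterion"
begin

text \<open>
  In bases ending with a generator of the annihilator, an algebra isomorphism is block triangular:
  it multiplies the last basis vector by a unit \<open>u\<close>, and its other diagonal block \<open>B\<close> is
  unimodular with \<open>B \<Theta>\<^sub>1 B\<^sup>T = u \<Theta>\<^sub>2\<close>; conversely every such pair
  gives an isomorphism. The entries outside the two diagonal blocks play no role since the last
  vector annihilates everything. Rescaling \<open>B\<close> by a unit changes \<open>u\<close> by a square, and for odd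
  \<open>p\<close> the p-adic units form two square classes, because squares modulo \<open>p\<close> lift and the product of
  two nonresidues is a residue.
\<close>

section \<open>Square classes of p-adic units\<close>

lemma padic_residue_Suc:
  fixes x :: "'p::prime_card padic_int"
  shows "[Rep_padic_int x (Suc k) = Rep_padic_int x k] (mod int CARD('p) ^ k)"
proof -
  have e: "Rep_padic_int x (Suc k) mod int CARD('p) ^ k = Rep_padic_int x k" for k
    using Rep_padic_int[of x] by simp
  show ?thesis
    unfolding cong_def using e[of k] by (metis mod_mod_trivial)
qed

lemma padic_residue_mod:
  fixes x :: "'p::prime_card padic_int"
  shows "Rep_padic_int x k mod int CARD('p) ^ k = Rep_padic_int x k"
  using Rep_padic_int[of x] by (metis (mono_tags, lifting) mem_Collect_eq mod_mod_trivial)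

lemma padic_unit_residue:
  fixes u :: "'p::prime_card padic_int"
  assumes "u dvd 1"
  shows "\<not> int CARD('p) dvd Rep_padic_int u 1"
proof
  assume "int CARD('p) dvd Rep_padic_int u 1"
  moreover obtain w where w: "1 = u * w"
    using assms by (elim dvdE)
  have "Rep_padic_int (u * w) 1 = 1 mod int CARD('p)"
    unfolding w[symmetric] by (simp add: one_padic_int.rep_eq)
  then have "(Rep_padic_int u 1 * Rep_padic_int w 1) mod int CARD('p) = 1 mod int CARD('p)"
    by (simp add: times_padic_int.rep_eq)
  ultimately have "int CARD('p) dvd 1"
    by (metis dvd_mult2 dvd_eq_mod_eq_0)
  then show False
    using prime_card[where 'a = 'p] not_prime_unit by auto
qed

text \<open>One Newton step: the derivative \<open>2 * y\<close> is invertible modulo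
  \<open>p\<close>, as \<open>p\<close> is odd and does not divide \<open>y\<close>, so an
  approximate root gains one power of \<open>p\<close> and keeps its earlier digits.\<close>

lemma square_root_lift:
  fixes p :: nat and a y :: int
  assumes "prime p" "odd p" "\<not> int p dvd y" "[y\<^sup>2 = a] (mod int p ^ Suc k)"
  shows "\<exists>z. [z\<^sup>2 = a] (mod int p ^ Suc (Suc k)) \<and> [z = y] (mod int p ^ Suc k)"
proof -
  have "coprime y (int p)"
    using assms(1,3) by (metis coprime_commute prime_imp_coprime prime_nat_int_transfer)
  moreover have "coprime 2 (int p)"
    using assms(2) by simp
  ultimately have "coprime (2 * y) (int p)"
    by simp
  then obtain v where v: "[2 * y * v = 1] (mod int p)"
    using cong_solve_coprime_int by blast
  obtain t where t: "y\<^sup>2 - a = int p ^ Suc k * t"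
    using assms(4) by (auto simp: cong_iff_dvd_diff elim: dvdE)
  \<comment> \<open>This choice makes \<open>2 * y * s + t\<close> vanish modulo \<open>p\<close>;
    times \<open>p ^ Suc k\<close>, it is the new error up to first order in
    \<open>s\<close>.\<close>
  define s where "s = - t * v"
  have "2 * y * s + t = - t * (2 * y * v - 1)"
    by (simp add: s_def algebra_simps)
  with v have "int p dvd 2 * y * s + t"
    by (simp add: cong_iff_dvd_diff)
  then obtain r where r: "2 * y * s + t = int p * r"
    by (elim dvdE)
  have "(y + int p ^ Suc k * s)\<^sup>2 - a = (y\<^sup>2 - a) + int p ^ Suc k * (2 * y * s) + int p ^ Suc k * int p ^ Suc k * s\<^sup>2"
    by (simp add: power2_eq_square algebra_simps)
  also have "\<dots> = int p ^ Suc k * (2 * y * s + t) + int p ^ Suc k * int p ^ Suc k * s\<^sup>2"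
    unfolding t by (simp add: algebra_simps)
  \<comment> \<open>The quadratic term carries \<open>p\<close> to the power
    \<open>2 * k + 2\<close>, which is at least \<open>k + 2\<close>.\<close>
  also have "\<dots> = int p ^ Suc (Suc k) * (r + int p ^ k * s\<^sup>2)"
    unfolding r by (simp add: algebra_simps)
  finally have "[(y + int p ^ Suc k * s)\<^sup>2 = a] (mod int p ^ Suc (Suc k))"
    by (simp add: cong_iff_dvd_diff del: power_Suc)
  moreover have "[y + int p ^ Suc k * s = y] (mod int p ^ Suc k)"
    by (simp add: cong_iff_dvd_diff del: power_Suc)
  ultimately show ?thesis
    by blast
qed

text \<open>Hensel's lemma for squares: compatible roots modulo all powers of \<open>p\<close>,
  found by repeated lifting, form a root in the inverse limit.\<close>

lemma padic_square_if_residue: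
  fixes u :: "'p::prime_card padic_int"
  assumes odd: "odd CARD('p)" and u: "u dvd 1" and qr: "QuadRes (int CARD('p)) (Rep_padic_int u 1)"
  shows "\<exists>v. u = v ^ 2"
proof -
  let ?p = "int CARD('p)" and ?u = "Rep_padic_int u"
  have p: "prime CARD('p)" by (rule prime_card)
  have pdvd: "?p dvd ?p ^ Suc k" for k by simp
  \<comment> \<open>All components from index 1 on agree modulo \<open>p\<close>, so none is
    divisible by \<open>p\<close>. This keeps the approximate roots prime to \<open>p\<close>, as
    each lifting step requires.\<close>
  have "[?u (Suc k) = ?u 1] (mod ?p)" for k
  proof (induction k)
    case (Suc k)
    have "[?u (Suc (Suc k)) = ?u (Suc k)] (mod ?p)"
      using padic_residue_Suc[of u "Suc k"] pdvd by (rule cong_dvd_modulus)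
    with Suc show ?case by (rule cong_trans[rotated])
  qed simp
  then have ndvd: "\<not> ?p dvd ?u (Suc k)" for k
    using padic_unit_residue[OF u] cong_dvd_iff by blast
  have "\<exists>y. \<forall>k. [(y k)\<^sup>2 = ?u (Suc k)] (mod ?p ^ Suc k) \<and> [y (Suc k) = y k] (mod ?p ^ Suc k)"
  proof (rule dependent_nat_choice)
    show "\<exists>y. [y\<^sup>2 = ?u (Suc 0)] (mod ?p ^ Suc 0)"
      using qr by (simp add: QuadRes_def)
  next
    fix y k assume y: "[y\<^sup>2 = ?u (Suc k)] (mod ?p ^ Suc k)"
    have "\<not> ?p dvd y\<^sup>2"
      using ndvd[of k] cong_dvd_modulus[OF y pdvd] cong_dvd_iff by blast
    then have "\<not> ?p dvd y"
      by (auto simp: power2_eq_square)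
    moreover have "[y\<^sup>2 = ?u (Suc (Suc k))] (mod ?p ^ Suc k)"
      using y padic_residue_Suc[of u "Suc k"] cong_sym cong_trans by blast
    ultimately show "\<exists>z. [z\<^sup>2 = ?u (Suc (Suc k))] (mod ?p ^ Suc (Suc k)) \<and> [z = y] (mod ?p ^ Suc k)"
      using square_root_lift[OF p odd] by blast
  qed
  then obtain y where y2: "\<And>k. [(y k)\<^sup>2 = ?u (Suc k)] (mod ?p ^ Suc k)"
    and y_Suc: "\<And>k. [y (Suc k) = y k] (mod ?p ^ Suc k)"
    by blast
  \<comment> \<open>Index \<open>k\<close> of a p-adic integer means modulus \<open>p ^ k\<close>,
    while \<open>y k\<close> is a root modulo \<open>p ^ Suc k\<close>; the surplus digit is
    dropped.\<close>
  define v where "v = (Abs_padic_int (\<lambda>k. y k mod ?p ^ k) :: 'p padic_int)"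
  have ppow: "?p ^ k dvd ?p ^ Suc k" for k by simp
  have "(y (Suc k) mod ?p ^ Suc k) mod ?p ^ k = y k mod ?p ^ k" for k
    unfolding residue_mod_power using cong_dvd_modulus[OF y_Suc ppow] by (simp add: cong_def)
  then have v: "Rep_padic_int v k = y k mod ?p ^ k" for k
    unfolding v_def by (subst Abs_padic_int_inverse) auto
  have "Rep_padic_int (v ^ 2) k = ?u k" for k
  proof -
    have "Rep_padic_int (v ^ 2) k = (y k)\<^sup>2 mod ?p ^ k"
      by (simp add: power2_eq_square times_padic_int.rep_eq v mod_mult_eq)
    also have "\<dots> = ?u (Suc k) mod ?p ^ k"
      using cong_dvd_modulus[OF y2 ppow] by (simp add: cong_def)
    also have "\<dots> = ?u k"
      using padic_residue_Suc[of u k] by (simp add: cong_def padic_residue_mod)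
    finally show ?thesis .
  qed
  then have "u = v ^ 2"
    by (metis Rep_padic_int_inject ext)
  then show ?thesis ..
qed

text \<open>Euler's criterion: raising to the power \<open>(p - 1) div 2\<close> gives -1 for both
  factors, so 1 for the product, whereas a nonresidue product would give -1.\<close>

lemma QuadRes_mult_nonresidues:
  fixes a b :: int
  assumes p: "prime p" "2 < p" and nz: "\<not> int p dvd a" "\<not> int p dvd b"
    and "\<not> QuadRes (int p) a" "\<not> QuadRes (int p) b"
  shows "QuadRes (int p) (a * b)"
proof (rule ccontr)
  assume nqr: "\<not> QuadRes (int p) (a * b)"
  have "\<not> int p dvd a * b"
    using p(1) nz by (simp add: prime_dvd_mult_iff)
  then have L: "Legendre a p = -1" "Legendre b p = -1" "Legendre (a * b) p = -1"
    using assms nqr by (auto simp: Legendre_def cong_0_iff)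
  have "[a ^ ((p - 1) div 2) * b ^ ((p - 1) div 2) = (-1) * (-1)] (mod int p)"
    using euler_criterion[OF p, of a] euler_criterion[OF p, of b] L
    by (intro cong_mult) (auto simp: cong_sym)
  moreover have "[a ^ ((p - 1) div 2) * b ^ ((p - 1) div 2) = -1] (mod int p)"
    using euler_criterion[OF p, of "a * b"] L by (simp add: power_mult_distrib cong_sym)
  ultimately have "[1 = -1] (mod int p)"
    by (metis cong_sym cong_trans mult_minus1 minus_minus)
  then have "int p dvd 2"
    by (simp add: cong_iff_dvd_diff)
  then show False
    using p(2) zdvd_imp_le by fastforce
qed

text \<open>A unit that is a residue modulo \<open>p\<close> is a square. Otherwise \<open>u\<close>
  and \<open>q\<close> are both nonresidues, \<open>u * q\<close> is a square, and dividing by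
  \<open>q\<close> puts \<open>u\<close> in the square class of \<open>q\<close>.\<close>

lemma padic_unit_square_class:
  fixes u q :: "'p::prime_card padic_int"
  assumes odd: "odd CARD('p)" and u: "u dvd 1" and q: "q dvd 1" and nsq: "\<nexists>r. q = r ^ 2"
  shows "\<exists>v. \<exists>\<epsilon>\<in>{1, q}. u = v ^ 2 * \<epsilon>"
proof (cases "QuadRes (int CARD('p)) (Rep_padic_int u 1)")
  case True
  then obtain v where "u = v ^ 2"
    using padic_square_if_residue[OF odd u] by blast
  then show ?thesis
    by (intro exI[of _ v] bexI[of _ 1]) auto
next
  case False
  have p: "prime CARD('p)" by (rule prime_card)
  have "CARD('p) > 2"
    using prime_gt_1_nat[OF p] odd by (cases "CARD('p) = 2") auto
  moreover have "\<not> QuadRes (int CARD('p)) (Rep_padic_int q 1)"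
    using padic_square_if_residue[OF odd q] nsq by blast
  ultimately have "QuadRes (int CARD('p)) (Rep_padic_int u 1 * Rep_padic_int q 1)"
    using QuadRes_mult_nonresidues[OF p] False padic_unit_residue[OF u] padic_unit_residue[OF q]
    by blast
  then have "QuadRes (int CARD('p)) (Rep_padic_int (u * q) 1)"
    by (simp add: QuadRes_def times_padic_int.rep_eq cong_def)
  moreover have "u * q dvd 1"
    using u q mult_dvd_mono by fastforce
  ultimately obtain v where v: "u * q = v ^ 2"
    using padic_square_if_residue[OF odd] by blast
  obtain w where w: "1 = q * w"
    using q by (elim dvdE)
  \<comment> \<open>Multiplying twice by \<open>q * w = 1\<close> leaves one factor \<open>q\<close>
    beside the square \<open>u * q * w\<^sup>2\<close>.\<close>
  have "u = u * (q * w) * (q * w)"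
    by (simp flip: w)
  also have "\<dots> = u * q * w\<^sup>2 * q"
    by (simp add: power2_eq_square ac_simps)
  also have "\<dots> = (v * w) ^ 2 * q"
    by (simp add: v power_mult_distrib)
  finally show ?thesis
    by blast
qed

section \<open>Bases of free modules\<close>

lemma basis_expand:
  assumes "Modules.module scale" "basis_family scale n e"
  obtains c where "x = (\<Sum>i<n. scale (c i) (e i))"
proof -
  interpret Modules.module scale by fact
  have inj: "inj_on e {..<n}" and "x \<in> span (e ` {..<n})"
    using assms(2) by (auto simp: basis_family_def)
  then obtain u where "x = (\<Sum>v\<in>e ` {..<n}. scale (u v) v)"
    by (auto simp: span_finite)
  then have "x = (\<Sum>i<n. scale (u (e i)) (e i))"
    by (simp add: sum.reindex[OF inj])
  then show ?thesis
    by (rule that)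
qed

lemma basis_unique:
  assumes "Modules.module scale" "basis_family scale n e"
    and eq: "(\<Sum>i<n. scale (c i) (e i)) = (\<Sum>i<n. scale (d i) (e i))" and "i < n"
  shows "c i = d i"
proof -
  interpret Modules.module scale by fact
  have inj: "inj_on e {..<n}" and ind: "independent (e ` {..<n})"
    using assms(2) by (auto simp: basis_family_def)
  \<comment> \<open>Independence speaks of coefficients attached to vectors, not to indices;
    injectivity of \<open>e\<close> allows passing between the two.\<close>
  let ?f = "\<lambda>v. c (inv_into {..<n} e v) - d (inv_into {..<n} e v)"
  have "(\<Sum>v\<in>e ` {..<n}. scale (?f v) v) = (\<Sum>i<n. scale (c i - d i) (e i))"
    by (simp add: sum.reindex[OF inj] inv_into_f_f[OF inj])
  also have "\<dots> = 0"
    using eq by (simp add: scale_left_diff_distrib sum_subtractf)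
  finally have "?f (e i) = 0"
    using \<open>i < n\<close> by (intro independentD[OF ind]) auto
  then show ?thesis
    using \<open>i < n\<close> by (simp add: inv_into_f_f[OF inj])
qed

lemma hom_eq_on_basis:
  assumes "basis_family s1 n e" "module_hom s1 s2 f" "module_hom s1 s2 g"
    and "\<And>i. i < n \<Longrightarrow> f (e i) = g (e i)"
  shows "f x = g x"
proof -
  interpret f: module_hom s1 s2 f by fact
  interpret g: module_hom s1 s2 g by fact
  obtain c where "x = (\<Sum>i<n. s1 (c i) (e i))"
    using basis_expand[OF f.m1.module_axioms assms(1)] .
  then show ?thesis
    using assms(4) by (simp add: f.sum g.sum f.scale g.scale)
qed

text \<open>Universal property of a free module: coordinates in a basis are unique, hence linear in
  the vector.\<close>

lemma hom_extension:
  assumes m1: "Modules.module s1" and m2: "Modules.module s2" and e: "basis_family s1 n e"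
  obtains h where "module_hom s1 s2 h" "\<And>i. i < n \<Longrightarrow> h (e i) = w i"
proof -
  interpret m1: Modules.module s1 by fact
  interpret m2: Modules.module s2 by fact
  \<comment> \<open>The choice determines \<open>c x i\<close> only for \<open>i < n\<close>; later
    values are arbitrary and never summed.\<close>
  define c where "c x = (SOME c. x = (\<Sum>i<n. s1 (c i) (e i)))" for x
  have c: "x = (\<Sum>i<n. s1 (c x i) (e i))" for x
  proof -
    have "\<exists>c. x = (\<Sum>i<n. s1 (c i) (e i))"
      by (rule basis_expand[OF m1 e, of x]) blast
    then show ?thesis
      unfolding c_def by (rule someI_ex)
  qed
  have c_eq: "c x i = d i" if "x = (\<Sum>i<n. s1 (d i) (e i))" "i < n" for x d i
    using that by (intro basis_unique[OF m1 e]) (simp_all flip: c)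
  define h where "h x = (\<Sum>i<n. s2 (c x i) (w i))" for x
  have "module_hom s1 s2 h"
    unfolding module_hom_iff
  proof (intro conjI allI m1 m2)
    fix x y a
    have "x + y = (\<Sum>i<n. s1 (c x i + c y i) (e i))"
      using c[of x] c[of y] by (simp add: m1.scale_left_distrib sum.distrib)
    note * = c_eq[OF this]
    show "h (x + y) = h x + h y"
      by (simp add: h_def * m2.scale_left_distrib sum.distrib)
    have "s1 a x = s1 a (\<Sum>i<n. s1 (c x i) (e i))"
      using c[of x] by simp
    also have "\<dots> = (\<Sum>i<n. s1 (a * c x i) (e i))"
      by (simp add: m1.scale_sum_right)
    finally have "s1 a x = (\<Sum>i<n. s1 (a * c x i) (e i))" .
    note * = c_eq[OF this]
    show "h (s1 a x) = s2 a (h x)"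
      by (simp add: h_def * m2.scale_sum_right)
  qed
  moreover have "h (e i) = w i" if "i < n" for i
  proof -
    have "e i = (\<Sum>j<n. s1 (if j = i then 1 else 0) (e j))"
      using that by (simp add: if_distrib[of "\<lambda>r. s1 r _"] sum.delta cong: if_cong)
    note * = c_eq[OF this]
    show ?thesis
      using that by (simp add: h_def * if_distrib[of "\<lambda>r. s2 r _"] sum.delta cong: if_cong)
  qed
  ultimately show ?thesis
    by (rule that)
qed

text \<open>The linear extensions given by \<open>H\<close> and \<open>K\<close> compose, in either
  order, to a map fixing a basis, hence to the identity.\<close>

lemma hom_of_inverse_matrices:
  assumes m1: "Modules.module s1" and m2: "Modules.module s2"
    and e: "basis_family s1 n e" and g: "basis_family s2 n g"
    and HK: "\<And>i l. i < n \<Longrightarrow> l < n \<Longrightarrow> (\<Sum>j<n. H i j * K j l) = (if i = l then 1 else 0)"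
    and KH: "\<And>i l. i < n \<Longrightarrow> l < n \<Longrightarrow> (\<Sum>j<n. K i j * H j l) = (if i = l then 1 else 0)"
  obtains h where "module_hom s1 s2 h" "bij h" "\<And>i. i < n \<Longrightarrow> h (e i) = (\<Sum>j<n. s2 (H i j) (g j))"
proof -
  obtain h where h: "module_hom s1 s2 h" "\<And>i. i < n \<Longrightarrow> h (e i) = (\<Sum>j<n. s2 (H i j) (g j))"
    using hom_extension[OF m1 m2 e, of "\<lambda>i. \<Sum>j<n. s2 (H i j) (g j)"] by blast
  obtain k where k: "module_hom s2 s1 k" "\<And>i. i < n \<Longrightarrow> k (g i) = (\<Sum>j<n. s1 (K i j) (e j))"
    using hom_extension[OF m2 m1 g, of "\<lambda>i. \<Sum>j<n. s1 (K i j) (e j)"] by blast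
  have comp: "k' (h' x) = x"
    if "module_hom t1 t2 h'" "module_hom t2 t1 k'" "basis_family t1 n b"
      "\<And>i. i < n \<Longrightarrow> h' (b i) = (\<Sum>j<n. t2 (F i j) (d j))"
      "\<And>i. i < n \<Longrightarrow> k' (d i) = (\<Sum>j<n. t1 (G i j) (b j))"
      "\<And>i l. i < n \<Longrightarrow> l < n \<Longrightarrow> (\<Sum>j<n. F i j * G j l) = (if i = l then 1 else 0)"
    for t1 :: "'a \<Rightarrow> 'x::ab_group_add \<Rightarrow> 'x" and t2 :: "'a \<Rightarrow> 'y::ab_group_add \<Rightarrow> 'y"
      and h' k' b d F G x
  proof -
    interpret h: module_hom t1 t2 h' by fact
    interpret k: module_hom t2 t1 k' by fact
    have hom: "module_hom t1 t1 (\<lambda>x. k' (h' x))" "module_hom t1 t1 (\<lambda>x. x)"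
      by (simp_all add: module_hom_iff h.m1.module_axioms h.add k.add h.scale k.scale)
    show ?thesis
    proof (rule hom_eq_on_basis[OF that(3) hom])
      fix i assume i: "i < n"
      have "k' (h' (b i)) = (\<Sum>j<n. t1 (F i j) (\<Sum>l<n. t1 (G j l) (b l)))"
        using i that(4,5) by (simp add: k.sum k.scale)
      also have "\<dots> = (\<Sum>j<n. \<Sum>l<n. t1 (F i j * G j l) (b l))"
        by (simp add: h.m1.scale_sum_right)
      also have "\<dots> = (\<Sum>l<n. t1 (\<Sum>j<n. F i j * G j l) (b l))"
        by (subst sum.swap) (simp add: h.m1.scale_sum_left)
      also have "\<dots> = b i"
        using i that(6) by (simp add: if_distrib[of "\<lambda>r. t1 r _"] sum.delta' cong: if_cong)
      finally show "k' (h' (b i)) = b i" .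
    qed
  qed
  have "k (h x) = x" for x
    using comp[OF h(1) k(1) e h(2) k(2) HK] .
  moreover have "h (k x) = x" for x
    using comp[OF k(1) h(1) g k(2) h(2) KH] .
  ultimately have "bij h"
    by (metis bijI')
  with h show ?thesis
    by (intro that)
qed

section \<open>Algebras whose products lie in a line\<close>

text \<open>Both sides are bilinear, so agreement on pairs of basis vectors extends first to
  arbitrary \<open>x\<close>, then to arbitrary \<open>y\<close>.\<close>

lemma hom_mul_on_basis:
  assumes "comm_algebra s1 mul1" "comm_algebra s2 mul2" "basis_family s1 n e" "module_hom s1 s2 h"
    and "\<And>i j. i < n \<Longrightarrow> j < n \<Longrightarrow> h (mul1 (e i) (e j)) = mul2 (h (e i)) (h (e j))"
  shows "h (mul1 x y) = mul2 (h x) (h y)"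
proof -
  interpret A1: comm_algebra s1 mul1 by fact
  interpret A2: comm_algebra s2 mul2 by fact
  interpret h: module_hom s1 s2 h by fact
  have hom: "module_hom s1 s2 (\<lambda>x. h (mul1 x y))" "module_hom s1 s2 (\<lambda>x. mul2 (h x) (h y))"
    "module_hom s1 s2 (\<lambda>y. h (mul1 x y))" "module_hom s1 s2 (\<lambda>y. mul2 (h x) (h y))" for x y
    using A1.linear_left[of y] A1.linear_right[of x] A2.linear_left[of "h y"] A2.linear_right[of "h x"]
    by (simp_all add: module_hom_iff h.add h.scale)
  have "h (mul1 x (e j)) = mul2 (h x) (h (e j))" if "j < n" for x j
    by (rule hom_eq_on_basis[OF assms(3) hom(1)[of "e j"] hom(2)[of "e j"]]) (rule assms(5)[OF _ that])
  then show ?thesis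
    by (rule hom_eq_on_basis[OF assms(3) hom(3)[of x] hom(4)[of x]])
qed

lemma inverse_algebra_hom:
  assumes k: "module_hom s1 s2 k" "\<And>x y. k (mul1 x y) = mul2 (k x) (k y)"
    and kh: "\<And>x. k (h x) = x" and hk: "\<And>x. h (k x) = x"
  shows "module_hom s2 s1 h" "h (mul2 x y) = mul1 (h x) (h y)"
proof -
  interpret k: module_hom s1 s2 k by fact
  show "module_hom s2 s1 h"
    unfolding module_hom_iff
  proof (intro conjI allI k.m1.module_axioms k.m2.module_axioms)
    show "h (x + y) = h x + h y" for x y
      using hk[of "h x + h y"] by (simp add: k.add kh)
    show "h (s2 a x) = s1 a (h x)" for a x
      using hk[of "s1 a (h x)"] by (simp add: k.scale kh)
  qed
  show "h (mul2 x y) = mul1 (h x) (h y)"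
    using hk[of "mul1 (h x) (h y)"] by (simp add: k(2) kh)
qed

lemma algebra_isomorphic_sym:
  assumes "algebra_isomorphic s1 mul1 s2 mul2"
  shows "algebra_isomorphic s2 mul2 s1 mul1"
proof -
  obtain f where f: "module_hom s1 s2 f" "bij f" "\<And>x y. f (mul1 x y) = mul2 (f x) (f y)"
    using assms by (auto simp: algebra_isomorphic_def)
  have "f (inv_into UNIV f x) = x" "inv_into UNIV f (f y) = y" for x y
    using f(2) by (simp_all add: bij_is_inj bij_is_surj surj_f_inv_f)
  note inverse_algebra_hom[of s1 s2 f mul1 mul2 "inv_into UNIV f", OF f(1,3) this]
  with bij_imp_bij_inv[OF f(2)] show ?thesis
    unfolding algebra_isomorphic_def by blast
qed

text \<open>Commutativity makes the annihilation two-sided, so components along the annihilator may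
  be dropped from either factor.\<close>

lemma annihilator_mul:
  assumes "comm_algebra scale mul" "z \<in> annihilator mul"
  shows "mul (scale c z) x = 0" "mul x (scale c z) = 0"
    "mul (x + scale c z) y = mul x y" "mul x (y + scale c z) = mul x y"
proof -
  interpret comm_algebra scale mul by fact
  have z: "mul z x = 0" "mul x z = 0" for x
    using assms(2) commute[of x z] by (auto simp: annihilator_def)
  show "mul (scale c z) x = 0" "mul x (scale c z) = 0"
    "mul (x + scale c z) y = mul x y" "mul x (y + scale c z) = mul x y"
    by (simp_all add: module_hom.add[OF linear_left] module_hom.scale[OF linear_left]
        module_hom.add[OF linear_right] module_hom.scale[OF linear_right] z)
qed

text \<open>On combinations of the \<open>e i\<close> the product is the bilinear form with Gram
  matrix \<open>\<Theta>\<close>, with values in the line of \<open>z\<close>.\<close>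

lemma mul_sum_basis:
  assumes "comm_algebra scale mul"
    and "\<And>i j. i < m \<Longrightarrow> j < m \<Longrightarrow> mul (e i) (e j) = scale (\<Theta> $$ (i, j)) z"
  shows "mul (\<Sum>i<m. scale (a i) (e i)) (\<Sum>j<m. scale (b j) (e j)) =
    scale (\<Sum>i<m. \<Sum>j<m. a i * \<Theta> $$ (i, j) * b j) z"
proof -
  interpret comm_algebra scale mul by fact
  note sums = module_hom.sum[OF linear_left] module_hom.sum[OF linear_right]
    module_hom.scale[OF linear_left] module_hom.scale[OF linear_right]
  show ?thesis
    by (simp add: sums assms(2) scale_sum_left scale_sum_right ac_simps, rule sum.swap)
qed

section \<open>Matrix congruence and unimodular matrices\<close>

text \<open>The form with Gram matrix \<open>\<Theta>\<close> is evaluated at rows \<open>i\<close>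
  and \<open>j\<close> of \<open>A\<close>, in the shape that \<open>mul_sum_basis\<close>
  produces.\<close>

lemma congruence_entry:
  fixes A \<Theta> :: "'a::comm_ring_1 mat"
  assumes "A \<in> carrier_mat m m" "\<Theta> \<in> carrier_mat m m" "i < m" "j < m"
  shows "(A * \<Theta> * transpose_mat A) $$ (i, j) = (\<Sum>k<m. \<Sum>l<m. A $$ (i, k) * \<Theta> $$ (k, l) * A $$ (j, l))"
  using assms by (simp add: scalar_prod_def lessThan_atLeast0 sum_distrib_left mult.assoc)

text \<open>Over any commutative ring, the adjugate divided by a unit determinant is a two-sided
  inverse.\<close>

lemma unimodular_inverse:
  assumes A: "A \<in> carrier_mat m m" and "unimodular A"
  obtains B where "B \<in> carrier_mat m m" "A * B = 1\<^sub>m m" "B * A = 1\<^sub>m m"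
proof -
  obtain d where d: "1 = det A * d"
    using assms(2) by (auto simp: unimodular_def elim: dvdE)
  have "A * (d \<cdot>\<^sub>m adj_mat A) = d \<cdot>\<^sub>m (det A \<cdot>\<^sub>m 1\<^sub>m m)"
    using adj_mat[OF A] A by (simp add: mult_smult_distrib)
  moreover have "d \<cdot>\<^sub>m adj_mat A * A = d \<cdot>\<^sub>m (det A \<cdot>\<^sub>m 1\<^sub>m m)"
    using adj_mat[OF A] A by (simp add: mult_smult_assoc_mat)
  moreover have "d \<cdot>\<^sub>m (det A \<cdot>\<^sub>m 1\<^sub>m m) = 1\<^sub>m m"
    using d by (intro eq_matI) (auto simp: mult.commute)
  ultimately show ?thesis
    using adj_mat(1)[OF A] by (intro that[of "d \<cdot>\<^sub>m adj_mat A"]) auto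
qed

lemma unimodular_if_right_inverse:
  assumes "A \<in> carrier_mat m m" "B \<in> carrier_mat m m" "A * B = 1\<^sub>m m"
  shows "unimodular A"
proof -
  have "det A * det B = 1"
    using det_mult[OF assms(1,2)] assms(3) by simp
  then show ?thesis
    using assms(1) by (auto simp: unimodular_def intro: dvdI[of _ _ "det B"])
qed

section \<open>Congruence of defining matrices and isomorphism\<close>

text \<open>The rows of \<open>A\<close> and the unit \<open>u\<close> give images in the first
  algebra of the basis of the second, and the congruence says that products match. The isomorphism
  is therefore built from the second algebra to the first.\<close>

lemma isomorphic_if_congruent:
  assumes A1: "comm_algebra s1 mul1" and A2: "comm_algebra s2 mul2"
    and D1: "defining_matrix s1 (Suc m) mul1 \<Theta>1" and D2: "defining_matrix s2 (Suc m) mul2 \<Theta>2"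
    and A: "A \<in> carrier_mat m m" "unimodular A" and u: "u dvd 1"
    and eq: "A * \<Theta>1 * transpose_mat A = u \<cdot>\<^sub>m \<Theta>2"
  shows "algebra_isomorphic s1 mul1 s2 mul2"
proof (rule algebra_isomorphic_sym)
  interpret A1: comm_algebra s1 mul1 by fact
  interpret A2: comm_algebra s2 mul2 by fact
  obtain e where e: "basis_family s1 (Suc m) e" and ann1: "annihilator mul1 = A1.span {e m}"
    and e_mul: "\<And>i j. i < m \<Longrightarrow> j < m \<Longrightarrow> mul1 (e i) (e j) = s1 (\<Theta>1 $$ (i, j)) (e m)"
    using D1 by (auto simp: defining_matrix_def)
  obtain g where g: "basis_family s2 (Suc m) g" and ann2: "annihilator mul2 = A2.span {g m}"
    and g_mul: "\<And>i j. i < m \<Longrightarrow> j < m \<Longrightarrow> mul2 (g i) (g j) = s2 (\<Theta>2 $$ (i, j)) (g m)"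
    using D2 by (auto simp: defining_matrix_def)
  have T: "\<Theta>1 \<in> carrier_mat m m" "\<Theta>2 \<in> carrier_mat m m"
    using D1 D2 by (auto simp: defining_matrix_def)
  obtain w where w: "1 = u * w"
    using u by (elim dvdE)
  obtain B where B: "B \<in> carrier_mat m m" "A * B = 1\<^sub>m m" "B * A = 1\<^sub>m m"
    using unimodular_inverse[OF A] .
  \<comment> \<open>\<open>H\<close> is block diagonal with blocks \<open>A\<close> and
    \<open>u\<close>, and \<open>K\<close> with their inverses; index \<open>m\<close> is the vector
    generating the annihilator.\<close>
  define H where "H i j = (if i < m \<and> j < m then A $$ (i, j) else if i = m \<and> j = m then u else 0)" for i j
  define K where "K i j = (if i < m \<and> j < m then B $$ (i, j) else if i = m \<and> j = m then w else 0)" for i j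
  have AB: "(\<Sum>k<m. A $$ (i, k) * B $$ (k, j)) = (if i = j then 1 else 0)"
    "(\<Sum>k<m. B $$ (i, k) * A $$ (k, j)) = (if i = j then 1 else 0)" if "i < m" "j < m" for i j
    using arg_cong[OF B(2), of "\<lambda>M. M $$ (i, j)"] arg_cong[OF B(3), of "\<lambda>M. M $$ (i, j)"] that A(1) B(1)
    by (simp_all add: scalar_prod_def lessThan_atLeast0)
  have HK: "(\<Sum>j<Suc m. H i j * K j l) = (if i = l then 1 else 0)"
    and KH: "(\<Sum>j<Suc m. K i j * H j l) = (if i = l then 1 else 0)" if "i < Suc m" "l < Suc m" for i l
    using that AB[of i l] w by (auto simp: H_def K_def less_Suc_eq mult.commute)
  obtain h where h: "module_hom s2 s1 h" "bij h"
    and hg: "\<And>i. i < Suc m \<Longrightarrow> h (g i) = (\<Sum>j<Suc m. s1 (H i j) (e j))"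
    using hom_of_inverse_matrices[OF A2.module_axioms A1.module_axioms g e HK KH] by blast
  interpret h: module_hom s2 s1 h by fact
  have em: "e m \<in> annihilator mul1" and gm: "g m \<in> annihilator mul2"
    by (auto simp: ann1 ann2 A1.span_base A2.span_base)
  have hg1: "h (g i) = (\<Sum>j<m. s1 (A $$ (i, j)) (e j))" if "i < m" for i
    using hg[of i] that by (simp add: H_def)
  have hg2: "h (g m) = s1 u (e m)"
    using hg[of m] by (simp add: H_def)
  have "h (mul2 (g i) (g j)) = mul1 (h (g i)) (h (g j))" if ij: "i < Suc m" "j < Suc m" for i j
  proof (cases "i < m \<and> j < m")
    case True
    have "mul1 (h (g i)) (h (g j)) = s1 ((A * \<Theta>1 * transpose_mat A) $$ (i, j)) (e m)"
      using True T A by (subst congruence_entry[of _ m]) (simp_all add: hg1 mul_sum_basis[OF A1 e_mul])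
    also have "\<dots> = h (mul2 (g i) (g j))"
      using True T by (simp add: eq g_mul h.scale hg2 mult.commute)
    finally show ?thesis ..
  next
    case False
    with ij have "i = m \<or> j = m" by linarith
    then show ?thesis
      \<comment> \<open>The instance \<open>c = 1\<close> covers \<open>g m\<close> itself; products
        involving the last vector vanish on both sides.\<close>
      using annihilator_mul(1,2)[OF A2 gm, where c = 1] annihilator_mul(1,2)[OF A1 em]
      by (auto simp: hg2)
  qed
  then have "h (mul2 x y) = mul1 (h x) (h y)" for x y
    by (rule hom_mul_on_basis[OF A2 A1 g h(1)])
  with h show "algebra_isomorphic s2 mul2 s1 mul1"
    by (auto simp: algebra_isomorphic_def)
qed

text \<open>A surjective algebra homomorphism maps annihilator into annihilator, so the last basis
  vector goes to a multiple of the last one. The other images split into a block \<open>B\<close>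
  and an annihilator component \<open>c\<close>.\<close>

lemma hom_block_triangular:
  assumes A1: "comm_algebra s1 mul1" and A2: "comm_algebra s2 mul2"
    and e: "basis_family s1 (Suc m) e"
    and ann1: "annihilator mul1 = Modules.module.span s1 {e m}"
    and ann2: "annihilator mul2 = Modules.module.span s2 {g m}"
    and h: "surj h" "\<And>x y. h (mul2 x y) = mul1 (h x) (h y)" "module_hom s2 s1 h"
  obtains B c u where "B \<in> carrier_mat m m"
    "\<And>i. i < m \<Longrightarrow> h (g i) = (\<Sum>j<m. s1 (B $$ (i, j)) (e j)) + s1 (c i) (e m)"
    "h (g m) = s1 u (e m)"
proof -
  interpret A1: comm_algebra s1 mul1 by fact
  interpret A2: comm_algebra s2 mul2 by fact
  interpret h: module_hom s2 s1 h by fact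
  have "\<exists>b. h (g i) = (\<Sum>j<Suc m. s1 (b j) (e j))" for i
    by (rule basis_expand[OF A1.module_axioms e, of "h (g i)"]) blast
  then have "\<exists>b. \<forall>i. h (g i) = (\<Sum>j<Suc m. s1 (b i j) (e j))"
    by (rule choice[OF allI])
  then obtain b where b: "\<And>i. h (g i) = (\<Sum>j<Suc m. s1 (b i j) (e j))"
    by blast
  have "g m \<in> annihilator mul2"
    by (auto simp: ann2 A2.span_base)
  then have "h (mul2 (g m) y) = 0" for y
    by (simp add: annihilator_def)
  then have "mul1 (h (g m)) (h y) = 0" for y
    by (simp only: h(2))
  \<comment> \<open>Surjectivity: every \<open>x\<close> is some \<open>h y\<close>.\<close>
  then have "mul1 (h (g m)) x = 0" for x
    using surjD[OF h(1), of x] by blast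
  then have "h (g m) \<in> annihilator mul1"
    by (simp add: annihilator_def)
  then obtain u where u: "h (g m) = s1 u (e m)"
    by (auto simp: ann1 A1.span_finite)
  show ?thesis
  proof (rule that)
    show "mat m m (\<lambda>(i, j). b i j) \<in> carrier_mat m m"
      by simp
    show "h (g i) = (\<Sum>j<m. s1 (mat m m (\<lambda>(i, j). b i j) $$ (i, j)) (e j)) + s1 (b i m) (e m)"
      if "i < m" for i
      using that by (simp add: b[of i])
  qed (rule u)
qed

text \<open>An isomorphism and its inverse are both block triangular. Comparing the diagonal blocks
  of their composite with the identity shows that \<open>B\<close> is unimodular and
  \<open>u\<close> a unit; comparing products gives the congruence.\<close>

lemma congruent_if_isomorphic:
  assumes A1: "comm_algebra s1 mul1" and A2: "comm_algebra s2 mul2"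
    and D1: "defining_matrix s1 (Suc m) mul1 \<Theta>1" and D2: "defining_matrix s2 (Suc m) mul2 \<Theta>2"
    and iso: "algebra_isomorphic s1 mul1 s2 mul2"
  obtains B u where "B \<in> carrier_mat m m" "unimodular B" "u dvd 1"
    "B * \<Theta>1 * transpose_mat B = u \<cdot>\<^sub>m \<Theta>2"
proof -
  interpret A1: comm_algebra s1 mul1 by fact
  interpret A2: comm_algebra s2 mul2 by fact
  obtain e where e: "basis_family s1 (Suc m) e" and ann1: "annihilator mul1 = A1.span {e m}"
    and e_mul: "\<And>i j. i < m \<Longrightarrow> j < m \<Longrightarrow> mul1 (e i) (e j) = s1 (\<Theta>1 $$ (i, j)) (e m)"
    using D1 by (auto simp: defining_matrix_def)
  obtain g where g: "basis_family s2 (Suc m) g" and ann2: "annihilator mul2 = A2.span {g m}"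
    and g_mul: "\<And>i j. i < m \<Longrightarrow> j < m \<Longrightarrow> mul2 (g i) (g j) = s2 (\<Theta>2 $$ (i, j)) (g m)"
    using D2 by (auto simp: defining_matrix_def)
  have T: "\<Theta>1 \<in> carrier_mat m m" "\<Theta>2 \<in> carrier_mat m m"
    using D1 D2 by (auto simp: defining_matrix_def)
  have em: "e m \<in> annihilator mul1"
    by (auto simp: ann1 A1.span_base)
  obtain k where k: "module_hom s1 s2 k" "bij k" "\<And>x y. k (mul1 x y) = mul2 (k x) (k y)"
    using iso by (auto simp: algebra_isomorphic_def)
  define h where "h = inv_into UNIV k"
  have kh: "k (h x) = x" for x
    using k(2) by (simp add: h_def bij_is_surj surj_f_inv_f)
  have hk: "h (k x) = x" for x
    using k(2) by (simp add: h_def bij_is_inj)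
  have surj: "surj h" "surj k"
    using surjI[of h k, OF hk] surjI[of k h, OF kh] by blast+
  note h = inverse_algebra_hom[of s1 s2 k mul1 mul2 h, OF k(1,3) kh hk]
  interpret h: module_hom s2 s1 h by fact
  interpret k: module_hom s1 s2 k by fact
  obtain B c u where B: "B \<in> carrier_mat m m"
    and hg: "\<And>i. i < m \<Longrightarrow> h (g i) = (\<Sum>j<m. s1 (B $$ (i, j)) (e j)) + s1 (c i) (e m)"
    and hgm: "h (g m) = s1 u (e m)"
    using hom_block_triangular[where m = m and e = e and g = g and h = h,
      OF A1 A2 e ann1 ann2 surj(1) h(2,1)] by blast
  obtain D d w where D: "D \<in> carrier_mat m m"
    and ke: "\<And>i. i < m \<Longrightarrow> k (e i) = (\<Sum>j<m. s2 (D $$ (i, j)) (g j)) + s2 (d i) (g m)"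
    and kem: "k (e m) = s2 w (g m)"
    using hom_block_triangular[where m = m and e = g and g = e and h = k,
      OF A2 A1 g ann2 ann1 surj(2) k(3,1)] by blast
  note uniq1 = basis_unique[OF A1.module_axioms e]
  note uniq2 = basis_unique[OF A2.module_axioms g]
  have "g m = k (h (g m))"
    by (simp add: kh)
  also have "\<dots> = s2 (u * w) (g m)"
    by (simp add: hgm k.scale kem)
  finally have "1 = u * w"
    \<comment> \<open>Both families are supported at \<open>m\<close>, so uniqueness of coordinates
      cancels the vector \<open>g m\<close>.\<close>
    using uniq2[of "\<lambda>i. if i = m then 1 else 0" "\<lambda>i. if i = m then u * w else 0" m] by simp
  then have u: "u dvd 1" ..
  have "(B * D) $$ (i, j) = 1\<^sub>m m $$ (i, j)" if ij: "i < m" "j < m" for i j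
  proof -
    have "(\<Sum>l<Suc m. s2 (if l = i then 1 else 0) (g l)) = g i"
      using ij by (simp add: if_distrib[of "\<lambda>r. s2 r _"] sum.delta cong: if_cong)
    also have "\<dots> = k (h (g i))"
      by (simp add: kh)
    \<comment> \<open>The annihilator components feed only the coefficient of \<open>g m\<close>;
      the first \<open>m\<close> coordinates are those of row \<open>i\<close> of
      \<open>B * D\<close>.\<close>
    also have "\<dots> = (\<Sum>k<m. s2 (B $$ (i, k)) (\<Sum>l<m. s2 (D $$ (k, l)) (g l))) +
        s2 ((\<Sum>k<m. B $$ (i, k) * d k) + c i * w) (g m)"
      using ij by (simp add: hg k.add k.sum k.scale ke kem A2.scale_right_distrib A2.scale_left_distrib
          sum.distrib A2.scale_sum_left ac_simps)
    also have "(\<Sum>k<m. s2 (B $$ (i, k)) (\<Sum>l<m. s2 (D $$ (k, l)) (g l))) =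
        (\<Sum>k<m. \<Sum>l<m. s2 (B $$ (i, k) * D $$ (k, l)) (g l))"
      by (simp add: A2.scale_sum_right)
    also have "\<dots> = (\<Sum>l<m. s2 (\<Sum>k<m. B $$ (i, k) * D $$ (k, l)) (g l))"
      by (subst sum.swap) (simp add: A2.scale_sum_left)
    finally have "(if j = i then 1 else 0) = (\<Sum>k<m. B $$ (i, k) * D $$ (k, j))"
      using uniq2[of "\<lambda>l. if l = i then 1 else 0" "\<lambda>l. if l < m then \<Sum>k<m. B $$ (i, k) * D $$ (k, l)
          else (\<Sum>k<m. B $$ (i, k) * d k) + c i * w" j] ij by simp
    then show ?thesis
      using ij B D by (auto simp: scalar_prod_def lessThan_atLeast0)
  qed
  then have "B * D = 1\<^sub>m m"
    using B D by (intro eq_matI) auto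
  then have "unimodular B"
    using unimodular_if_right_inverse B D by blast
  moreover have "B * \<Theta>1 * transpose_mat B = u \<cdot>\<^sub>m \<Theta>2"
  proof (rule eq_matI)
    fix i j assume "i < dim_row (u \<cdot>\<^sub>m \<Theta>2)" "j < dim_col (u \<cdot>\<^sub>m \<Theta>2)"
    then have ij: "i < m" "j < m"
      using T by auto
    \<comment> \<open>The terms \<open>c i\<close> drop out because \<open>e m\<close> annihilates
      everything.\<close>
    have "s1 ((B * \<Theta>1 * transpose_mat B) $$ (i, j)) (e m) = mul1 (h (g i)) (h (g j))"
      using ij B T by (subst congruence_entry[of _ m]) (simp_all add: hg annihilator_mul[OF A1 em] mul_sum_basis[OF A1 e_mul])
    also have "\<dots> = h (mul2 (g i) (g j))"
      by (simp add: h(2))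
    also have "\<dots> = s1 (u * \<Theta>2 $$ (i, j)) (e m)"
      using ij by (simp add: g_mul h.scale hgm mult.commute)
    finally show "(B * \<Theta>1 * transpose_mat B) $$ (i, j) = (u \<cdot>\<^sub>m \<Theta>2) $$ (i, j)"
      using uniq1[of "\<lambda>i'. if i' = m then (B * \<Theta>1 * transpose_mat B) $$ (i, j) else 0"
          "\<lambda>i'. if i' = m then u * \<Theta>2 $$ (i, j) else 0" m] ij T by simp
  qed (use B T in auto)
  ultimately show ?thesis
    using B u by (intro that)
qed

section \<open>Removal of the square factor and the equivalence\<close>

text \<open>Since \<open>v\<close> divides a unit it has an inverse \<open>w\<close>; replacing
  \<open>B\<close> by \<open>w\<close> times \<open>B\<close> multiplies the congruence by
  \<open>w\<^sup>2\<close>, which cancels \<open>v\<^sup>2\<close>.\<close>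

lemma congruence_absorb_square:
  fixes B \<Theta>1 \<Theta>2 :: "'a::comm_ring_1 mat"
  assumes B: "B \<in> carrier_mat m m" and T: "\<Theta>1 \<in> carrier_mat m m" "\<Theta>2 \<in> carrier_mat m m"
    and uB: "unimodular B" and u: "v ^ 2 * \<epsilon> dvd 1"
    and eq: "B * \<Theta>1 * transpose_mat B = (v ^ 2 * \<epsilon>) \<cdot>\<^sub>m \<Theta>2"
  obtains A where "A \<in> carrier_mat m m" "unimodular A" "A * \<Theta>1 * transpose_mat A = \<epsilon> \<cdot>\<^sub>m \<Theta>2"
proof -
  obtain x where "1 = v ^ 2 * \<epsilon> * x"
    using u by (elim dvdE)
  then have "v * (v * \<epsilon> * x) = 1"
    by (simp add: power2_eq_square ac_simps)
  then obtain w where w: "v * w = 1"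
    by blast
  obtain C where C: "C \<in> carrier_mat m m" "B * C = 1\<^sub>m m"
    using unimodular_inverse[OF B uB] by blast
  let ?A = "w \<cdot>\<^sub>m B"
  have A: "?A \<in> carrier_mat m m"
    using B by simp
  \<comment> \<open>An explicit right inverse yields unimodularity of the rescaled matrix.\<close>
  have "?A * (v \<cdot>\<^sub>m C) = w \<cdot>\<^sub>m (v \<cdot>\<^sub>m (B * C))"
    using mult_smult_assoc_mat[OF B smult_carrier_mat[OF C(1)]] mult_smult_distrib[OF B C(1)] by metis
  also have "\<dots> = 1\<^sub>m m"
    unfolding C(2) using w by (intro eq_matI) (auto simp: mult.commute)
  finally have "?A * (v \<cdot>\<^sub>m C) = 1\<^sub>m m" .
  then have "unimodular ?A"
    using C A by (intro unimodular_if_right_inverse[of _ m "v \<cdot>\<^sub>m C"]) auto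
  moreover have "?A * \<Theta>1 * transpose_mat ?A = \<epsilon> \<cdot>\<^sub>m \<Theta>2"
  proof (rule eq_matI)
    fix i j assume "i < dim_row (\<epsilon> \<cdot>\<^sub>m \<Theta>2)" "j < dim_col (\<epsilon> \<cdot>\<^sub>m \<Theta>2)"
    then have ij: "i < m" "j < m"
      using T by auto
    have "(?A * \<Theta>1 * transpose_mat ?A) $$ (i, j) = w * w * (B * \<Theta>1 * transpose_mat B) $$ (i, j)"
      unfolding congruence_entry[OF A T(1) ij] congruence_entry[OF B T(1) ij]
      using ij B by (simp add: sum_distrib_left ac_simps)
    also have "\<dots> = (v * w) * (v * w) * \<epsilon> * \<Theta>2 $$ (i, j)"
      using ij T by (simp add: eq power2_eq_square ac_simps)
    finally show "(?A * \<Theta>1 * transpose_mat ?A) $$ (i, j) = (\<epsilon> \<cdot>\<^sub>m \<Theta>2) $$ (i, j)"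
      using ij T w by simp
  qed (use B T in auto)
  ultimately show ?thesis
    using A by (intro that)
qed

theorem proposition5p7:
  fixes scale :: "'p::prime_card padic_int \<Rightarrow> 'm::ab_group_add \<Rightarrow> 'm"
    and mul1 mul2 :: "'m \<Rightarrow> 'm \<Rightarrow> 'm"
    and n :: nat
    and \<Theta>1 \<Theta>2 :: "'p padic_int mat"
    and q :: "'p padic_int"
  assumes "odd CARD('p)"
    and "n > 0"
    and "Modules.module scale" and "free_of_rank scale n"
    and "comm_algebra scale mul1" and "nilpotent3 mul1"
    and "cyclic_submodule scale (annihilator mul1)"
    and "comm_algebra scale mul2" and "nilpotent3 mul2"
    and "cyclic_submodule scale (annihilator mul2)"
    and "defining_matrix scale n mul1 \<Theta>1"
    and "defining_matrix scale n mul2 \<Theta>2"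
    and "q dvd 1" and "\<nexists>r. q = r ^ 2"
  shows "algebra_isomorphic scale mul1 scale mul2 \<longleftrightarrow>
    (\<exists>A \<in> carrier_mat (n - 1) (n - 1). \<exists>\<epsilon> \<in> {1, q}.
       unimodular A \<and> A * \<Theta>1 * transpose_mat A = \<epsilon> \<cdot>\<^sub>m \<Theta>2)"
proof -
  obtain m where n: "n = Suc m"
    using \<open>n > 0\<close> by (cases n) auto
  note D = assms(11,12)[unfolded n]
  have T: "\<Theta>1 \<in> carrier_mat m m" "\<Theta>2 \<in> carrier_mat m m"
    using D by (auto simp: defining_matrix_def)
  show ?thesis
    unfolding n diff_Suc_1
  proof
    assume "algebra_isomorphic scale mul1 scale mul2"
    then obtain B u where B: "B \<in> carrier_mat m m" "unimodular B" and u: "u dvd 1"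
      and eq: "B * \<Theta>1 * transpose_mat B = u \<cdot>\<^sub>m \<Theta>2"
      by (rule congruent_if_isomorphic[OF assms(5,8) D])
    \<comment> \<open>The isomorphism supplies some unit \<open>u\<close>; its square class is
      represented by 1 or \<open>q\<close>, and the square factor is then moved into the
      matrix.\<close>
    obtain v \<epsilon> where \<epsilon>: "\<epsilon> \<in> {1, q}" and v: "u = v ^ 2 * \<epsilon>"
      using padic_unit_square_class[OF assms(1) u assms(13,14)] by blast
    obtain A where "A \<in> carrier_mat m m" "unimodular A" "A * \<Theta>1 * transpose_mat A = \<epsilon> \<cdot>\<^sub>m \<Theta>2"
      by (rule congruence_absorb_square[OF B(1) T B(2) u[unfolded v] eq[unfolded v]])
    with \<epsilon> show "\<exists>A \<in> carrier_mat m m. \<exists>\<epsilon> \<in> {1, q}.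
       unimodular A \<and> A * \<Theta>1 * transpose_mat A = \<epsilon> \<cdot>\<^sub>m \<Theta>2"
      by blast
  next
    assume "\<exists>A \<in> carrier_mat m m. \<exists>\<epsilon> \<in> {1, q}.
       unimodular A \<and> A * \<Theta>1 * transpose_mat A = \<epsilon> \<cdot>\<^sub>m \<Theta>2"
    then obtain A \<epsilon> where "A \<in> carrier_mat m m" "\<epsilon> \<in> {1, q}" "unimodular A"
      "A * \<Theta>1 * transpose_mat A = \<epsilon> \<cdot>\<^sub>m \<Theta>2"
      by blast
    \<comment> \<open>The converse construction works for any unit factor, and both 1 and
      \<open>q\<close> are units.\<close>
    moreover from this have "\<epsilon> dvd 1"
      using assms(13) by auto
    ultimately show "algebra_isomorphic scale mul1 scale mul2"
      using isomorphic_if_congruent[OF assms(5,8) D] by blast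
  qed
qed

end
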